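(* Let $n\geq 1$ and let $F\subseteq\mathbb{R}^n$ be finite. Then the following are equivalent: (1) There is a Steinhaus set $S\subseteq\mathbb{R}^n$ for $F$ in $\mathbb{R}^n$. (2) The chromatic number of $G(\mathbb{R}^n,D(F))$ is at most $|F|$.
   Context: An isometric copy of $X\subseteq\mathbb{R}^n$ is the image of $X$ under an isometry of $\mathbb{R}^n$. A set $S\subseteq\mathbb{R}^n$ is a Steinhaus set for $X$ in $\mathbb{R}^n$ if $|Y\cap S|=1$ for every isometric copy $Y$ of $X$ in $\mathbb{R}^n$. Let $d(p,q)$ denote Euclidean distance. For a finite set $F\subseteq\mathbb{R}^n$, $D(F)=\{d(p,q) : p,q\in F,\ p\neq q\}$. For a set $D$ of positive reals, $G(\mathbb{R}^n,D)$ is the graph with vertex set $\mathbb{R}^n$ in which $p,q$ are joined by an edge iff $d(p,q)\in D$. The chromatic number of a graph is the smallest $k$ such that its vertices can be partitioned into $k$ sets none of which contains two adjacent vertices. *)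

theory Defs
  imports "HOL-Analysis.Analysis" "HOL-Library.Extended_Nat" "HOL-Library.Disjoint_Sets"
begin

definition isometry :: "('a::metric_space \<Rightarrow> 'a) \<Rightarrow> bool" where
  "isometry f \<longleftrightarrow> bij f \<and> (\<forall>x y. dist (f x) (f y) = dist x y)"

definition isometric_copy :: "'a::metric_space set \<Rightarrow> 'a set \<Rightarrow> bool" where
  "isometric_copy X Y \<longleftrightarrow> (\<exists>f. isometry f \<and> Y = f ` X)"

(* card A = 1 holds only for one-element sets: infinite sets have card 0. *)
definition Steinhaus_set :: "'a::metric_space set \<Rightarrow> 'a set \<Rightarrow> bool" where
  "Steinhaus_set X S \<longleftrightarrow> (\<forall>Y. isometric_copy X Y \<longrightarrow> card (Y \<inter> S) = 1)"

definition distance_set :: "'a::metric_space set \<Rightarrow> real set" where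
  "distance_set F = {dist p q | p q. p \<in> F \<and> q \<in> F \<and> p \<noteq> q}"

(* An undirected graph is a pair (V, E) of a vertex set and a set of two-element edges {p, q}. *)
type_synonym 'a graph = "'a set \<times> 'a set set"

(* Simple (loop-free) when all elements of D are positive. *)
definition distance_graph :: "real set \<Rightarrow> 'a::metric_space graph" where
  "distance_graph D = (UNIV, {{p, q} | p q. dist p q \<in> D})"

definition independent_in :: "'a graph \<Rightarrow> 'a set \<Rightarrow> bool" where
  "independent_in G A \<longleftrightarrow> (\<forall>p\<in>A. \<forall>q\<in>A. {p, q} \<notin> snd G)"

(* The infimum in enat of a nonempty set is its least element; it is \<infinity> if no finite k works. *)
definition chromatic_number :: "'a graph \<Rightarrow> enat" where
  "chromatic_number G =
     Inf {enat k | k. \<exists>P. partition_on (fst G) P \<and> finite P \<and> card P = k \<and>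
                          (\<forall>A\<in>P. independent_in G A)}"

end

theory Submission
  imports Defs
begin

text \<open>
  The points of any isometric copy \<open>Y\<close> of \<open>F\<close> are pairwise adjacent in
  \<open>G(\<real>\<^sup>n, D(F))\<close>, and conversely, since the isometries of \<open>\<real>\<^sup>n\<close> act
  transitively on pairs of points at a given distance, every edge lies in an isometric copy of
  \<open>F\<close>.  These two facts give the two implications.

  If \<open>S\<close> is a Steinhaus set, then every translate \<open>x + F\<close> contains exactly one
  point \<open>x + f\<close> of \<open>S\<close>; colour \<open>x\<close> by this \<open>f\<close>.  If two adjacent
  points \<open>x\<close> and \<open>y\<close> had the same colour \<open>f\<close>, then \<open>x + f\<close> and
  \<open>y + f\<close> would be two points of \<open>S\<close> joined by an edge, so the copy of \<open>F\<close>
  through that edge would meet \<open>S\<close> twice (\<open>chromatic_number_le_if_Steinhaus\<close>).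

  If the graph has a proper colouring with at most \<open>|F|\<close> colours, then the
  \<open>|F|\<close> points of a copy of \<open>F\<close> receive distinct colours.  Hence all colours occur,
  each exactly once, and any single colour class is a Steinhaus set
  (\<open>Steinhaus_set_if_colouring\<close>).
\<close>

section \<open>Chromatic numbers\<close>

lemma Inf_in_enat:
  fixes K :: "enat set"
  assumes "K \<noteq> {}"
  shows "Inf K \<in> K"
  using assms LeastI_ex[of "\<lambda>k. k \<in> K"] by (auto simp: Inf_enat_def)

lemma chromatic_number_le_iff:
  "chromatic_number G \<le> enat k \<longleftrightarrow>
     (\<exists>P. partition_on (fst G) P \<and> finite P \<and> card P \<le> k \<and> (\<forall>A\<in>P. independent_in G A))"
    (is "?L \<longleftrightarrow> (\<exists>P. ?R P)")
proof
  let ?K = "{enat k | k. \<exists>P. partition_on (fst G) P \<and> finite P \<and> card P = k \<and>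
                          (\<forall>A\<in>P. independent_in G A)}"
  {
    assume le: ?L
    have "Inf ?K \<noteq> \<infinity>"
      using le unfolding chromatic_number_def by (metis infinity_ileE)
    then have "?K \<noteq> {}"
      unfolding Inf_enat_def by argo
    \<comment> \<open>As \<^typ>\<open>enat\<close> is well-ordered, the infimum is attained.\<close>
    then have "Inf ?K \<in> ?K"
      by (rule Inf_in_enat)
    with le show "\<exists>P. ?R P"
      unfolding chromatic_number_def by auto
  next
    assume "\<exists>P. ?R P"
    then obtain P where P: "?R P" ..
    then have "chromatic_number G \<le> enat (card P)"
      unfolding chromatic_number_def by (intro Inf_lower) blast
    with P show ?L
      by (meson enat_ord_simps(1) order_trans)
  }
qed

text \<open>
  The fibres of a colouring form a partition once the empty ones are removed, so that unused
  colours only improve the bound.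
\<close>

lemma chromatic_number_le_colouring:
  assumes "finite C" and "c ` fst G \<subseteq> C"
    and proper: "\<And>x y. x \<in> fst G \<Longrightarrow> y \<in> fst G \<Longrightarrow> c x = c y \<Longrightarrow> {x, y} \<notin> snd G"
  shows "chromatic_number G \<le> enat (card C)"
proof -
  define P where "P = (\<lambda>i. {x \<in> fst G. c x = i}) ` (c ` fst G)"
  have fin: "finite (c ` fst G)"
    using assms finite_subset by blast
  have "partition_on (fst G) P"
    unfolding P_def partition_on_def disjoint_def by auto
  moreover have "finite P"
    unfolding P_def using fin by blast
  moreover have "card P \<le> card C"
    unfolding P_def using card_image_le[OF fin] card_mono[OF assms(1,2)] by (rule order_trans)
  moreover have "\<forall>A\<in>P. independent_in G A"
    unfolding P_def independent_in_def using proper by auto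
  ultimately show ?thesis
    unfolding chromatic_number_le_iff by blast
qed

lemma edge_distance_graph_iff:
  "{p, q} \<in> snd (distance_graph D) \<longleftrightarrow> dist p q \<in> D"
  by (auto simp: distance_graph_def doubleton_eq_iff dist_commute)

lemma fst_distance_graph [simp]: "fst (distance_graph D) = UNIV"
  by (simp add: distance_graph_def)

section \<open>Isometric copies\<close>

lemma isometric_copy_translation:
  fixes X :: "'a::real_normed_vector set"
  shows "isometric_copy X ((+) a ` X)"
  unfolding isometric_copy_def isometry_def by (intro exI[of _ "(+) a"]) simp

lemma isometric_copy_card: "isometric_copy X Y \<Longrightarrow> card Y = card X"
  unfolding isometric_copy_def isometry_def bij_def
  by (auto intro: card_image inj_on_subset)

lemma isometric_copy_distance_set:
  fixes X Y :: "'a::metric_space set"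
  assumes "isometric_copy X Y"
  shows "distance_set Y \<subseteq> distance_set X"
proof
  fix d assume "d \<in> distance_set Y"
  with assms obtain f :: "'a \<Rightarrow> 'a"
    where f: "\<And>x y. dist (f x) (f y) = dist x y" and "d \<in> distance_set (f ` X)"
    unfolding isometric_copy_def isometry_def by auto
  then obtain a b where ab: "a \<in> X" "b \<in> X" "f a \<noteq> f b" "d = dist (f a) (f b)"
    unfolding distance_set_def by blast
  with f have "d = dist a b" "a \<noteq> b"
    by auto
  with ab(1,2) show "d \<in> distance_set X"
    unfolding distance_set_def by blast
qed

text \<open>
  Two-point homogeneity of Euclidean space: an orthogonal map takes the vector \<open>q - p\<close> to
  the vector \<open>y - x\<close> of the same length, and translations adjust the starting points.
\<close>

lemma isometry_between_equidistant_pairs: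
  fixes p q x y :: "real ^ 'n"
  assumes "dist p q = dist x y"
  obtains g where "isometry g" "g p = x" "g q = y"
proof -
  have "norm (q - p) = norm (y - x)"
    using assms by (simp add: dist_norm norm_minus_commute)
  then obtain f where f: "orthogonal_transformation f" "f (q - p) = y - x"
    using orthogonal_transformation_exists by blast
  define g where "g z = x + f (z - p)" for z
  have lin: "linear f"
    using f(1) by (rule orthogonal_transformation_linear)
  have "bij ((+) x \<circ> f \<circ> (+) (- p))"
    using orthogonal_transformation_bij[OF f(1)] by (intro bij_comp) auto
  also have "(+) x \<circ> f \<circ> (+) (- p) = g"
    by (simp add: g_def fun_eq_iff)
  finally have "bij g" .
  moreover have "dist (g u) (g v) = dist u v" for u v
  proof -
    have "g u - g v = f (u - v)"
      by (simp add: g_def linear_diff[OF lin])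
    then show ?thesis
      by (simp add: dist_norm orthogonal_transformation_norm[OF f(1)])
  qed
  ultimately have "isometry g"
    by (simp add: isometry_def)
  moreover have "g p = x" "g q = y"
    using f(2) linear_0[OF lin] by (auto simp: g_def)
  ultimately show thesis
    by (rule that)
qed

lemma edge_in_isometric_copy:
  fixes x y :: "real ^ 'n"
  assumes "dist x y \<in> distance_set F"
  obtains Y where "isometric_copy F Y" "x \<in> Y" "y \<in> Y" "x \<noteq> y"
proof -
  obtain p q where pq: "p \<in> F" "q \<in> F" "p \<noteq> q" "dist p q = dist x y"
    using assms unfolding distance_set_def by auto
  obtain g where g: "isometry g" "g p = x" "g q = y"
    using isometry_between_equidistant_pairs[OF pq(4)] .
  show thesis
  proof (rule that)
    show "isometric_copy F (g ` F)"
      using g(1) unfolding isometric_copy_def by blast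
    show "x \<noteq> y"
      using pq(3,4) by auto
  qed (use g pq in auto)
qed

section \<open>Steinhaus sets and colourings\<close>

text \<open>
  Adjacent points of a Steinhaus set would lie in a common copy of \<open>F\<close>.
\<close>

lemma Steinhaus_set_no_edge:
  fixes S :: "(real ^ 'n) set"
  assumes S: "Steinhaus_set F S" and "x \<in> S" "y \<in> S"
  shows "dist x y \<notin> distance_set F"
proof
  assume "dist x y \<in> distance_set F"
  then obtain Y where Y: "isometric_copy F Y" "x \<in> Y" "y \<in> Y" "x \<noteq> y"
    by (rule edge_in_isometric_copy)
  have "card (Y \<inter> S) = 1"
    using S Y(1) unfolding Steinhaus_set_def by blast
  then show False
    using Y(2-4) assms(2,3) by (metis IntI card_1_singletonE singletonD)
qed

text \<open>
  A point \<open>x\<close> is coloured by the \<open>f \<in> F\<close> with \<open>x + f \<in> S\<close>.  The class of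
  the colour \<open>f\<close> is then a translate of \<open>S\<close>, hence independent.
\<close>

lemma chromatic_number_le_if_Steinhaus:
  fixes S :: "(real ^ 'n) set"
  assumes "finite F" and S: "Steinhaus_set F S"
  shows "chromatic_number (distance_graph (distance_set F) :: (real ^ 'n) graph) \<le> enat (card F)"
proof -
  have "\<exists>f\<in>F. x + f \<in> S" for x
  proof -
    have "card ((+) x ` F \<inter> S) = 1"
      using S isometric_copy_translation unfolding Steinhaus_set_def by blast
    then have "(+) x ` F \<inter> S \<noteq> {}"
      by force
    then show ?thesis
      by blast
  qed
  then obtain c where c: "\<And>x. c x \<in> F" "\<And>x. x + c x \<in> S"
    by metis
  show ?thesis
  proof (rule chromatic_number_le_colouring[OF assms(1), of c])
    fix x y :: "real ^ 'n"
    assume "c x = c y"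
    then have "dist (x + c x) (y + c y) = dist x y"
      by simp
    then show "{x, y} \<notin> snd (distance_graph (distance_set F))"
      using Steinhaus_set_no_edge[OF S c(2) c(2), of x y]
      by (simp add: edge_distance_graph_iff)
  qed (use c(1) in auto)
qed

text \<open>
  The colouring is injective on each copy of \<open>F\<close>, and there are at most \<open>|F|\<close>
  classes, so by counting it is onto: the class \<open>S\<close> is met, and met only once.
\<close>

lemma Steinhaus_set_if_colouring:
  fixes F :: "'a::metric_space set"
  assumes P: "partition_on UNIV P" "finite P" "card P \<le> card F"
    and indep: "\<And>A. A \<in> P \<Longrightarrow> independent_in (distance_graph (distance_set F)) A"
    and "S \<in> P"
  shows "Steinhaus_set F S"
  unfolding Steinhaus_set_def
proof (intro allI impI)
  fix Y assume Y: "isometric_copy F Y"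
  have unique: "u = v" if "u \<in> Y" "v \<in> Y" "A \<in> P" "u \<in> A" "v \<in> A" for u v A
  proof (rule ccontr)
    assume "u \<noteq> v"
    with that(1,2) have "dist u v \<in> distance_set F"
      by (intro subsetD[OF isometric_copy_distance_set[OF Y]]) (auto simp: distance_set_def)
    then show False
      using indep[OF that(3)] that(4,5)
      unfolding independent_in_def edge_distance_graph_iff by blast
  qed
  have "\<forall>x. \<exists>A\<in>P. x \<in> A"
    using partition_onD1[OF P(1)] by blast
  then obtain c where c: "\<And>x. c x \<in> P" "\<And>x. x \<in> c x"
    by metis
  have "inj_on c Y"
    using unique c by (metis inj_onI)
  then have "card (c ` Y) = card F"
    using isometric_copy_card[OF Y] by (simp add: card_image)
  then have "c ` Y = P"
    using c(1) P(2,3) by (intro card_seteq) auto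
  then obtain y where y: "y \<in> Y" "y \<in> S"
    using \<open>S \<in> P\<close> c(2) by (metis imageE)
  then have "Y \<inter> S = {y}"
    using unique \<open>S \<in> P\<close> by blast
  then show "card (Y \<inter> S) = 1"
    by simp
qed

theorem proposition1p3:
  fixes F :: "(real ^ 'n) set"
  assumes "finite F"
  shows "(\<exists>S :: (real ^ 'n) set. Steinhaus_set F S) \<longleftrightarrow>
         chromatic_number (distance_graph (distance_set F) :: (real ^ 'n) graph) \<le> enat (card F)"
proof
  assume "\<exists>S :: (real ^ 'n) set. Steinhaus_set F S"
  then show "chromatic_number (distance_graph (distance_set F) :: (real ^ 'n) graph) \<le> enat (card F)"
    using chromatic_number_le_if_Steinhaus[OF assms] by blast
next
  assume "chromatic_number (distance_graph (distance_set F) :: (real ^ 'n) graph) \<le> enat (card F)"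
  then obtain P :: "(real ^ 'n) set set" where
    P: "partition_on UNIV P" "finite P" "card P \<le> card F"
       "\<forall>A\<in>P. independent_in (distance_graph (distance_set F)) A"
    unfolding chromatic_number_le_iff by auto
  have "\<Union>P = UNIV"
    using P(1) by (simp add: partition_on_def)
  then obtain S where "S \<in> P"
    by blast
  then show "\<exists>S. Steinhaus_set F S"
    using Steinhaus_set_if_colouring[OF P(1-3)] P(4) by blast
qed

end
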